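(* For each $N\in\mathbb{N}$, the statistical model $\mathscr{E}:=\{C([0,T];\mathbb{R}^N),\mathcal{B}(C([0,T];\mathbb{R}^N)),\mathbb{P}_N^\theta,\theta\in\mathbb{R}_+\}$ is regular in $\mathbb{R}_+$; that is: (a) $\theta\mapsto\frac{d\mathbb{P}_N^\theta}{d\mathbb{P}_N}(U_N)$ is a continuous function of $\theta\in\mathbb{R}_+$, $\mathbb{P}$-almost surely; (b) $\{\mathbb{P}_N^\theta,\theta\in\mathbb{R}_+\}$ has finite Fisher information at each $\theta\in\mathbb{R}_+$; (c) the function $\theta\mapsto\psi(U_N,\theta):=\frac{\partial}{\partial\theta}\sqrt{\frac{d\mathbb{P}_N^\theta}{d\mathbb{P}_N}(U_N)}$ is continuous in $L^2(\Omega;\mathbb{P})$ on $\mathbb{R}_+$.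
   Context: $\mathbb{R}_+:=(0,\infty)$. $(\Omega,\mathscr{F},\{\mathscr{F}_t\},\mathbb{P})$ is a stochastic basis satisfying the usual assumptions, with independent standard Brownian motions $\{w_k\}_{k\in\mathbb{N}}$. $\{\mu_k\}\subset(0,\infty)$ with $\mu_k\to\infty$ (the eigenvalues of a positive definite self-adjoint operator $A$ on a separable Hilbert space), $\{q_k\}\subset(0,\infty)$, $\sigma>0$ and $T>0$ are fixed and known. For $\theta\in\mathbb{R}_+$, $u_k^\theta$ is the $k$-th Fourier mode of the solution of $du+\theta Au\,dt=\sigma\sum_ku_kh_kq_k\,dw_k$ ($h_k$ the eigenvectors of $A$), i.e. $du_k^\theta=-\theta\mu_ku_k^\theta\,dt+\sigma q_ku_k^\theta\,dw_k$, so $u_k^\theta(t)=u_k(0)\exp\big(-(\theta\mu_k+\tfrac12\sigma^2q_k^2)t+\sigma q_kw_k(t)\big)$, $t\in[0,T]$, with $\mathscr{F}_0$-measurable $u_k(0)\ne0$ not depending on $\theta$. $U_N^\theta:=\{(u_1^\theta(t),\dots,u_N^\theta(t)),t\in[0,T]\}$ and $\mathbb{P}_N^\theta$ is its law on $C([0,T];\mathbb{R}^N)$. $\theta_0\in\mathbb{R}_+$ is the true parameter value; $u_k:=u_k^{\theta_0}$, $U_N:=U_N^{\theta_0}$, $\mathbb{P}_N:=\mathbb{P}_N^{\theta_0}$. The measures $\mathbb{P}_N^\theta$ and $\mathbb{P}_N$ are equivalent with $$\frac{d\mathbb{P}_N^\theta}{d\mathbb{P}_N}(U_N)=\exp\Big(\frac{\theta_0-\theta}{\sigma^2}\sum_{k=1}^N\mu_kq_k^{-2}\int_0^T\frac{du_k(t)}{u_k(t)}+\frac{(\theta_0^2-\theta^2)T}{2\sigma^2}\sum_{k=1}^N\mu_k^2q_k^{-2}\Big).$$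 This formula holds for any reference value in place of $\theta_0$. The Fisher information at $\theta$ is $\mathbb{E}\Big(\big(\tfrac{\partial}{\partial\theta'}\ln\tfrac{d\mathbb{P}_N^{\theta'}}{d\mathbb{P}_N^{\theta}}(U_N^{\theta})\big|_{\theta'=\theta}\big)^2\Big)$. *)

theory Defs
  imports "HOL-Probability.Probability"
begin

section \<open>The path space \<open>C([0,T]; R^N)\<close>\<close>

text \<open>
  The dimension \<open>N\<close> is a term, so vectors of \<open>R^N\<close> are extensional functions on \<open>{1..N}\<close>.
\<close>

definition rvec_metric :: "nat \<Rightarrow> (nat \<Rightarrow> real) metric" where
  "rvec_metric N = metric ({1..N} \<rightarrow>\<^sub>E UNIV, \<lambda>x y. L2_set (\<lambda>k. x k - y k) {1..N})"

lemma Metric_space_rvec: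
  "Metric_space ({1..N} \<rightarrow>\<^sub>E (UNIV :: real set)) (\<lambda>x y. L2_set (\<lambda>k. x k - y k) {1..N})"
  for N :: nat
proof (unfold_locales)
  fix x y z :: "nat \<Rightarrow> real"
  show "0 \<le> L2_set (\<lambda>k. x k - y k) {1..N}" by simp
  show "L2_set (\<lambda>k. x k - y k) {1..N} = L2_set (\<lambda>k. y k - x k) {1..N}"
    by (simp add: L2_set_def power2_commute)
  show "L2_set (\<lambda>k. x k - y k) {1..N} = 0 \<longleftrightarrow> x = y"
    if "x \<in> {1..N} \<rightarrow>\<^sub>E UNIV" "y \<in> {1..N} \<rightarrow>\<^sub>E UNIV"
    using that by (auto simp: L2_set_eq_0_iff intro: PiE_ext[OF that])
  show "L2_set (\<lambda>k. x k - z k) {1..N}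
      \<le> L2_set (\<lambda>k. x k - y k) {1..N} + L2_set (\<lambda>k. y k - z k) {1..N}"
    using L2_set_triangle_ineq[of "\<lambda>k. x k - y k" "\<lambda>k. y k - z k" "{1..N}"] by simp
qed

lemma mspace_rvec_metric [simp]: "mspace (rvec_metric N) = {1..N} \<rightarrow>\<^sub>E UNIV"
  and mdist_rvec_metric [simp]:
    "mdist (rvec_metric N) = (\<lambda>x y. L2_set (\<lambda>k. x k - y k) {1..N})"
  unfolding rvec_metric_def
  by (rule Metric_space.mspace_metric[OF Metric_space_rvec]
        Metric_space.mdist_metric[OF Metric_space_rvec])+

text \<open>Continuous paths with the uniform metric; a path is extensional on \<open>{0..T}\<close>.\<close>

definition path_metric :: "real \<Rightarrow> nat \<Rightarrow> (real \<Rightarrow> nat \<Rightarrow> real) metric" where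
  "path_metric T N = cfunspace (top_of_set {0..T}) (rvec_metric N)"

definition path_borel :: "real \<Rightarrow> nat \<Rightarrow> (real \<Rightarrow> nat \<Rightarrow> real) measure" where
  "path_borel T N =
     sigma (mspace (path_metric T N)) {B. openin (mtopology_of (path_metric T N)) B}"


section \<open>Stochastic basis, Brownian motions, stochastic integral\<close>

text \<open>Only times \<open>t \<ge> 0\<close> are relevant; values at negative times are left unconstrained.\<close>

definition stochastic_basis :: "'a measure \<Rightarrow> (real \<Rightarrow> 'a measure) \<Rightarrow> bool" where
  "stochastic_basis M F \<longleftrightarrow>
     prob_space M \<and> complete_measure M \<and>
     (\<forall>t\<ge>0. subalgebra M (F t)) \<and>
     (\<forall>s\<ge>0. \<forall>t\<ge>s. sets (F s) \<subseteq> sets (F t)) \<and>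
     null_sets M \<subseteq> sets (F 0) \<and>
     (\<forall>t\<ge>0. sets (F t) = (\<Inter>s\<in>{t<..}. sets (F s)))"

definition brownian_motion ::
  "'a measure \<Rightarrow> (real \<Rightarrow> 'a measure) \<Rightarrow> (real \<Rightarrow> 'a \<Rightarrow> real) \<Rightarrow> bool" where
  "brownian_motion M F W \<longleftrightarrow>
     (\<forall>t\<ge>0. W t \<in> borel_measurable (F t)) \<and>
     (AE \<omega> in M. W 0 \<omega> = 0) \<and>
     (\<forall>\<omega>\<in>space M. continuous_on {0..} (\<lambda>t. W t \<omega>)) \<and>
     (\<forall>s\<ge>0. \<forall>t>s.
        distributed M lborel (\<lambda>\<omega>. W t \<omega> - W s \<omega>) (normal_density 0 (sqrt (t - s))) \<and>
        prob_space.indep_set M (sets (F s))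
          (sets (vimage_algebra (space M) (\<lambda>\<omega>. W t \<omega> - W s \<omega>) borel)))"

text \<open>Independence of the whole processes \<open>w 1, w 2, \<dots>\<close>, not only of their marginals.\<close>

definition independent_brownian_motions ::
  "'a measure \<Rightarrow> (real \<Rightarrow> 'a measure) \<Rightarrow> (nat \<Rightarrow> real \<Rightarrow> 'a \<Rightarrow> real) \<Rightarrow> bool" where
  "independent_brownian_motions M F w \<longleftrightarrow>
     (\<forall>k\<ge>1. brownian_motion M F (w k)) \<and>
     prob_space.indep_vars M (\<lambda>_. \<Pi>\<^sub>M t\<in>{0..}. borel) (\<lambda>k \<omega>. \<lambda>t\<in>{0..}. w k t \<omega>) {1..}"

text \<open>
  The Ito integral of \<open>X\<close> against \<open>Y\<close> over \<open>[0,T]\<close>, for a continuous adapted integrand \<open>X\<close> and a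
  continuous semimartingale \<open>Y\<close>: the limit in probability of the left-endpoint Riemann sums as
  the mesh of the partition tends to \<open>0\<close>.  It is determined up to null sets, and \<open>ito_integral\<close>
  is some version of it.
\<close>

definition has_ito_integral ::
  "'a measure \<Rightarrow> real \<Rightarrow> (real \<Rightarrow> 'a \<Rightarrow> real) \<Rightarrow> (real \<Rightarrow> 'a \<Rightarrow> real) \<Rightarrow> ('a \<Rightarrow> real) \<Rightarrow> bool" where
  "has_ito_integral M T X Y I \<longleftrightarrow>
     I \<in> borel_measurable M \<and>
     (\<forall>\<epsilon>>0. \<exists>\<delta>>0. \<forall>n (s :: nat \<Rightarrow> real).
        s 0 = 0 \<and> s n = T \<and> (\<forall>i<n. s i \<le> s (Suc i) \<and> s (Suc i) - s i < \<delta>) \<longrightarrow>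
        measure M {\<omega> \<in> space M.
          \<epsilon> < \<bar>(\<Sum>i<n. X (s i) \<omega> * (Y (s (Suc i)) \<omega> - Y (s i) \<omega>)) - I \<omega>\<bar>} < \<epsilon>)"

definition ito_integral ::
  "'a measure \<Rightarrow> real \<Rightarrow> (real \<Rightarrow> 'a \<Rightarrow> real) \<Rightarrow> (real \<Rightarrow> 'a \<Rightarrow> real) \<Rightarrow> 'a \<Rightarrow> real" where
  "ito_integral M T X Y = (SOME I. has_ito_integral M T X Y I)"


section \<open>The Fourier modes and their law\<close>

text \<open>
  The solution of \<open>du = - \<theta> \<mu>\<^sub>k u dt + \<sigma> q\<^sub>k u dw\<^sub>k\<close> started at \<open>u0 k\<close>.
\<close>

definition mode ::
  "(nat \<Rightarrow> real) \<Rightarrow> (nat \<Rightarrow> real) \<Rightarrow> real \<Rightarrow> (nat \<Rightarrow> 'a \<Rightarrow> real) \<Rightarrow> (nat \<Rightarrow> real \<Rightarrow> 'a \<Rightarrow> real) \<Rightarrow>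
   real \<Rightarrow> nat \<Rightarrow> real \<Rightarrow> 'a \<Rightarrow> real" where
  "mode \<mu> q \<sigma> u0 w \<theta> k t \<omega> =
     u0 k \<omega> * exp (- (\<theta> * \<mu> k + \<sigma>\<^sup>2 * (q k)\<^sup>2 / 2) * t + \<sigma> * q k * w k t \<omega>)"

definition path_of :: "real \<Rightarrow> nat \<Rightarrow> (nat \<Rightarrow> real \<Rightarrow> 'a \<Rightarrow> real) \<Rightarrow> 'a \<Rightarrow> real \<Rightarrow> nat \<Rightarrow> real" where
  "path_of T N u \<omega> = (\<lambda>t\<in>{0..T}. \<lambda>k\<in>{1..N}. u k t \<omega>)"

definition path_law ::
  "'a measure \<Rightarrow> real \<Rightarrow> nat \<Rightarrow> (nat \<Rightarrow> real \<Rightarrow> 'a \<Rightarrow> real) \<Rightarrow> (real \<Rightarrow> nat \<Rightarrow> real) measure" where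
  "path_law M T N u = distr M (path_borel T N) (path_of T N u)"

text \<open>
  \<open>p\<close> is a version of the Radon-Nikodym derivative of \<open>Q\<close> with respect to \<open>P\<close>.
\<close>

definition is_RN_density :: "'b measure \<Rightarrow> 'b measure \<Rightarrow> ('b \<Rightarrow> real) \<Rightarrow> bool" where
  "is_RN_density P Q p \<longleftrightarrow>
     p \<in> borel_measurable P \<and> (\<forall>x\<in>space P. 0 \<le> p x) \<and> density P (\<lambda>x. ennreal (p x)) = Q"

text \<open>
  The likelihood ratio at \<open>\<theta>\<close> with reference value \<open>\<eta>\<close>, along the path generated with parameter \<open>\<eta>\<close>;
  the argument \<open>u\<close> is the family of modes generated with parameter \<open>\<eta>\<close>.
\<close>

definition girsanov_density ::
  "'a measure \<Rightarrow> (nat \<Rightarrow> real) \<Rightarrow> (nat \<Rightarrow> real) \<Rightarrow> real \<Rightarrow> real \<Rightarrow> nat \<Rightarrow>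
   (nat \<Rightarrow> real \<Rightarrow> 'a \<Rightarrow> real) \<Rightarrow> real \<Rightarrow> real \<Rightarrow> 'a \<Rightarrow> real" where
  "girsanov_density M \<mu> q \<sigma> T N u \<eta> \<theta> \<omega> =
     exp ((\<eta> - \<theta>) / \<sigma>\<^sup>2 *
            (\<Sum>k=1..N. \<mu> k / (q k)\<^sup>2 * ito_integral M T (\<lambda>t \<omega>. 1 / u k t \<omega>) (u k) \<omega>)
          + (\<eta>\<^sup>2 - \<theta>\<^sup>2) * T / (2 * \<sigma>\<^sup>2) * (\<Sum>k=1..N. (\<mu> k)\<^sup>2 / (q k)\<^sup>2))"


section \<open>Regularity notions\<close>

text \<open>
  \<open>L \<theta> \<omega>\<close> is the likelihood ratio at \<open>\<theta>\<close>, with reference value \<open>\<eta>\<close>, evaluated at the observation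
  generated under \<open>\<eta>\<close>; the Fisher information at \<open>\<eta>\<close> is the second moment of the score.
\<close>

definition score :: "(real \<Rightarrow> 'a \<Rightarrow> real) \<Rightarrow> real \<Rightarrow> 'a \<Rightarrow> real" where
  "score L \<eta> \<omega> = deriv (\<lambda>\<theta>. ln (L \<theta> \<omega>)) \<eta>"

definition finite_fisher_information :: "'a measure \<Rightarrow> (real \<Rightarrow> 'a \<Rightarrow> real) \<Rightarrow> real \<Rightarrow> bool" where
  "finite_fisher_information M L \<eta> \<longleftrightarrow>
     (AE \<omega> in M. (\<lambda>\<theta>. ln (L \<theta> \<omega>)) differentiable (at \<eta>)) \<and>
     integrable M (\<lambda>\<omega>. (score L \<eta> \<omega>)\<^sup>2)"

definition L2_continuous_on :: "'a measure \<Rightarrow> real set \<Rightarrow> (real \<Rightarrow> 'a \<Rightarrow> real) \<Rightarrow> bool" where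
  "L2_continuous_on M S \<psi> \<longleftrightarrow>
     (\<forall>\<theta>\<in>S. \<psi> \<theta> \<in> borel_measurable M \<and> integrable M (\<lambda>\<omega>. (\<psi> \<theta> \<omega>)\<^sup>2)) \<and>
     (\<forall>\<theta>\<in>S. ((\<lambda>\<theta>'. \<integral>\<omega>. (\<psi> \<theta>' \<omega> - \<psi> \<theta> \<omega>)\<^sup>2 \<partial>M) \<longlongrightarrow> 0) (at \<theta> within S))"

end

theory Submission
  imports Defs
begin

text \<open>
  For a fixed reference value \<open>\<eta>\<close>, the likelihood ratio along the path generated under \<open>\<eta>\<close> is
  almost surely \<open>exp ((\<eta> - \<theta>) S + (\<eta>\<^sup>2 - \<theta>\<^sup>2) B)\<close>, where \<open>S\<close> is a random variable (a weighted sum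
  of the stochastic integrals of \<open>du\<^sub>k / u\<^sub>k\<close>) and \<open>B\<close> is a constant.  The model is thus a
  one-parameter exponential family with statistic \<open>S\<close>, and continuity of the likelihood in \<open>\<theta>\<close>
  is immediate.

  The other two properties need moments of \<open>S\<close>.  One could evaluate the stochastic integrals,
  which shows that \<open>S\<close> is Gaussian.  The proof below takes the route usual for exponential
  families instead: a density integrates to \<open>1\<close>, so for every \<open>\<theta> > 0\<close> the variable
  \<open>exp ((\<eta> - \<theta>) S)\<close> is integrable; in other words \<open>exp (c S)\<close> is integrable for every \<open>c < \<eta>\<close>.
  Since \<open>{..<\<eta>}\<close> is open, the factor \<open>S\<^sup>2\<close> can be absorbed into a small change of \<open>c\<close>
  (\<open>square_mult_exp_le\<close>), so \<open>S\<^sup>2 exp (c S)\<close> is integrable for all \<open>c < \<eta>\<close> as well.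

  The score at \<open>\<eta>\<close> is \<open>- S - 2 \<eta> B\<close>, and \<open>c = 0\<close> gives its finite second moment; this is where
  \<open>\<eta> > 0\<close> enters.  The square of the derivative of the root likelihood at \<open>\<theta>\<close> is
  \<open>(S + 2 \<theta> B)\<^sup>2 / 4\<close> times the likelihood.  For all parameters within \<open>\<theta> / 2\<close> of \<open>\<theta>\<close> it is
  bounded by one combination of such integrable terms, because a tilt \<open>exp (a S)\<close> with \<open>a\<close> in an
  interval is at most the sum of the tilts at the endpoints.  Dominated convergence then gives
  continuity in \<open>L\<^sup>2\<close>.

  Moving the normalisation of the densities from path space to \<open>\<Omega>\<close> requires that the random path
  is measurable for the Borel sets of the uniform metric (\<open>measurable_path_borel\<close>).  This rests
  on the separability of the path space.
\<close>

section \<open>Measurability of random paths\<close>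

lemma continuous_map_rvec_metric_iff:
  "continuous_map (top_of_set A) (mtopology_of (rvec_metric N)) x \<longleftrightarrow>
     x \<in> A \<rightarrow> ({1..N} \<rightarrow>\<^sub>E UNIV) \<and> (\<forall>k\<in>{1..N}. continuous_on A (\<lambda>t. x t k))"
  for A :: "real set"
proof -
  interpret R: Metric_space "{1..N} \<rightarrow>\<^sub>E (UNIV :: real set)" "\<lambda>x y. L2_set (\<lambda>k. x k - y k) {1..N}"
    by (rule Metric_space_rvec)
  have top: "mtopology_of (rvec_metric N) = R.mtopology"
    by (simp add: mtopology_of_def)
  show ?thesis
  proof (intro iffI conjI ballI)
    assume x: "continuous_map (top_of_set A) (mtopology_of (rvec_metric N)) x"
    then show "x \<in> A \<rightarrow> ({1..N} \<rightarrow>\<^sub>E UNIV)"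
      unfolding top using continuous_map_funspace
      by (fastforce simp only: topspace_euclidean_subtopology R.topspace_mtopology)
    fix k assume k: "k \<in> {1..N}"
    show "continuous_on A (\<lambda>t. x t k)"
      unfolding continuous_on_iff
    proof (intro ballI allI impI)
      fix t \<epsilon> :: real assume t: "t \<in> A" and "0 < \<epsilon>"
      then obtain U where U: "openin (top_of_set A) U" "t \<in> U"
        "\<forall>s\<in>U. x s \<in> R.mball (x t) \<epsilon>"
        using x unfolding top R.continuous_map_to_metric topspace_euclidean_subtopology by blast
      then obtain \<delta> where "\<delta> > 0" and \<delta>: "\<And>s. s \<in> A \<Longrightarrow> dist s t < \<delta> \<Longrightarrow> s \<in> U"
        unfolding openin_euclidean_subtopology_iff by metis
      have "dist (x s k) (x t k) < \<epsilon>" if "s \<in> A" "dist s t < \<delta>" for s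
      proof -
        have "\<bar>x t k - x s k\<bar> \<le> L2_set (\<lambda>k. \<bar>x t k - x s k\<bar>) {1..N}"
          by (rule member_le_L2_set) (use k in auto)
        also have "\<dots> = L2_set (\<lambda>k. x t k - x s k) {1..N}"
          by (simp add: L2_set_def)
        also have "\<dots> < \<epsilon>" using U(3) \<delta>[OF that] by (auto simp del: One_nat_def)
        finally show ?thesis by (simp add: dist_real_def)
      qed
      then show "\<exists>d>0. \<forall>s\<in>A. dist s t < d \<longrightarrow> dist (x s k) (x t k) < \<epsilon>"
        using \<open>\<delta> > 0\<close> by blast
    qed
  next
    assume x: "x \<in> A \<rightarrow> ({1..N} \<rightarrow>\<^sub>E UNIV) \<and> (\<forall>k\<in>{1..N}. continuous_on A (\<lambda>t. x t k))"
    show "continuous_map (top_of_set A) (mtopology_of (rvec_metric N)) x"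
      unfolding top R.continuous_map_to_metric
    proof (intro ballI allI impI)
      fix t \<epsilon> :: real assume t: "t \<in> topspace (top_of_set A)" and "0 < \<epsilon>"
      define \<rho> where "\<rho> s = L2_set (\<lambda>k. x t k - x s k) {1..N}" for s
      have "continuous_on A \<rho>"
        unfolding \<rho>_def L2_set_def using x by (intro continuous_intros) auto
      then have "openin (top_of_set A) (A \<inter> \<rho> -` {..<\<epsilon>})"
        by (simp add: continuous_openin_preimage_gen)
      moreover have "t \<in> A \<inter> \<rho> -` {..<\<epsilon>}"
        using t \<open>0 < \<epsilon>\<close> by (simp add: \<rho>_def L2_set_def)
      moreover have "\<forall>s\<in>A \<inter> \<rho> -` {..<\<epsilon>}. x s \<in> R.mball (x t) \<epsilon>"
        using x t by (auto simp: \<rho>_def Pi_iff simp del: One_nat_def)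
      ultimately show "\<exists>U. openin (top_of_set A) U \<and> t \<in> U \<and> (\<forall>s\<in>U. x s \<in> R.mball (x t) \<epsilon>)"
        by blast
    qed
  qed
qed

lemma mspace_path_metric_iff:
  "x \<in> mspace (path_metric T N) \<longleftrightarrow>
     x \<in> {0..T} \<rightarrow>\<^sub>E ({1..N} \<rightarrow>\<^sub>E UNIV) \<and> (\<forall>k\<in>{1..N}. continuous_on {0..T} (\<lambda>t. x t k))"
  by (subst path_metric_def, subst compactin_mspace_cfunspace)
     (auto simp: continuous_map_rvec_metric_iff compactin_subtopology PiE_iff extensional_def)

text \<open>
  Countably many cells replace a countable dense set of paths.  A cell consists of the paths close,
  at the times in \<open>D\<close>, to a step function with jumps at the multiples of \<open>1/m\<close> and values in the
  multiples of \<open>1/n\<close>; the matrix \<open>c\<close> lists these values.  The step function itself is not a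
  continuous path.  For countable \<open>D\<close>, membership in a cell is a countable conjunction of
  conditions on single coordinates.
\<close>
definition path_cell ::
  "real set \<Rightarrow> nat \<Rightarrow> int list list \<times> nat \<times> nat \<Rightarrow> (real \<Rightarrow> nat \<Rightarrow> real) set" where
  "path_cell D N = (\<lambda>(c, m, n). {x. \<forall>t\<in>D. \<forall>k\<in>{1..N}.
     \<bar>x t k - real_of_int (c ! nat \<lfloor>real m * t\<rfloor> ! k) / real n\<bar> \<le> 2 / real n})"

text \<open>
  Uniform continuity on the compact time interval makes the value at a grid point a good
  approximation on the whole grid interval; rounding it down costs another \<open>1/n\<close>.
\<close>
lemma path_in_fine_cell:
  assumes x: "x \<in> mspace (path_metric T N)" and D: "D \<subseteq> {0..T}" and n: "0 < n"
  obtains c m where "x \<in> path_cell D N (c, m, n)"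
proof -
  have "\<exists>\<delta>>0. \<forall>s\<in>{0..T}. \<forall>t\<in>{0..T}. dist t s < \<delta> \<longrightarrow> dist (x t k) (x s k) < 1 / real n"
    if "k \<in> {1..N}" for k
  proof -
    have "uniformly_continuous_on {0..T} (\<lambda>t. x t k)"
      using x that by (intro compact_uniformly_continuous) (auto simp: mspace_path_metric_iff)
    then show ?thesis using n unfolding uniformly_continuous_on_def by simp
  qed
  then obtain \<delta> where \<delta>0: "\<And>k. k \<in> {1..N} \<Longrightarrow> 0 < \<delta> k"
    and \<delta>: "\<And>k s t. k \<in> {1..N} \<Longrightarrow> s \<in> {0..T} \<Longrightarrow> t \<in> {0..T} \<Longrightarrow> dist t s < \<delta> k
              \<Longrightarrow> dist (x t k) (x s k) < 1 / real n"
    by metis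
  \<comment> \<open>The \<open>1\<close> keeps the minimum defined when \<open>N = 0\<close>.\<close>
  define d where "d = Min (insert 1 (\<delta> ` {1..N}))"
  have d0: "0 < d" using \<delta>0 by (simp add: d_def)
  have d: "d \<le> \<delta> k" if "k \<in> {1..N}" for k
    unfolding d_def by (rule Min_le) (use that in auto)
  obtain m :: nat where m: "1 / d < real m" using reals_Archimedean2 by blast
  have m0: "0 < real m" using m d0 by (meson less_trans zero_less_divide_1_iff)
  define J where "J = nat \<lfloor>real m * T\<rfloor>"
  define c where "c = map (\<lambda>j. map (\<lambda>k. \<lfloor>real n * x (real j / real m) k\<rfloor>) [0..<Suc N]) [0..<Suc J]"
  have "\<bar>x t k - real_of_int (c ! nat \<lfloor>real m * t\<rfloor> ! k) / real n\<bar> \<le> 2 / real n"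
    if "t \<in> D" "k \<in> {1..N}" for t k
  proof -
    have t: "t \<in> {0..T}" using that D by auto
    define j where "j = nat \<lfloor>real m * t\<rfloor>"
    have mt: "0 \<le> real m * t" "real m * t \<le> real m * T"
      using t m0 by auto
    have j: "real j \<le> real m * t" "real m * t < real j + 1"
      unfolding j_def using mt by linarith+
    have "j \<le> J" unfolding j_def J_def using mt by (intro nat_mono floor_mono)
    then have cj: "c ! j ! k = \<lfloor>real n * x (real j / real m) k\<rfloor>"
      using that(2) by (simp add: c_def del: upt_Suc)
    define s where "s = real j / real m"
    have s: "0 \<le> s" "s \<le> t" "t - s < 1 / real m"
      using j m0 by (auto simp: s_def pos_divide_le_eq diff_less_eq add_divide_distrib[symmetric]
          pos_less_divide_eq mult.commute)
    have "1 / real m < d" using m m0 d0 by (simp add: field_simps)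
    then have "dist t s < \<delta> k" using s d[OF that(2)] by (simp add: dist_real_def)
    then have 1: "\<bar>x t k - x s k\<bar> < 1 / real n"
      using \<delta>[of k s t] that(2) s t by (auto simp: dist_real_def)
    have "\<bar>real n * x s k - real_of_int (c ! j ! k)\<bar> \<le> 1"
      unfolding cj s_def[symmetric] by linarith
    then have "\<bar>real n * x s k - real_of_int (c ! j ! k)\<bar> / real n \<le> 1 / real n"
      by (rule divide_right_mono) simp
    also have "\<bar>real n * x s k - real_of_int (c ! j ! k)\<bar> / real n
        = \<bar>x s k - real_of_int (c ! j ! k) / real n\<bar>"
    proof -
      have "x s k - real_of_int (c ! j ! k) / real n = (real n * x s k - real_of_int (c ! j ! k)) / real n"
        using n by (simp add: field_simps)
      then show ?thesis by (simp add: abs_divide)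
    qed
    finally have "\<bar>x s k - real_of_int (c ! j ! k) / real n\<bar> \<le> 1 / real n" .
    with 1 have "\<bar>x t k - real_of_int (c ! j ! k) / real n\<bar> \<le> 1 / real n + 1 / real n"
      by linarith
    then show ?thesis by (simp add: j_def)
  qed
  then show thesis by (intro that[of c m]) (simp add: path_cell_def)
qed

text \<open>
  By continuity, a bound on the difference of two paths at the times in a dense set holds at all
  times.
\<close>
lemma path_cell_diameter:
  assumes x: "x \<in> mspace (path_metric T N)" "x \<in> path_cell D N (c, m, n)"
    and y: "y \<in> mspace (path_metric T N)" "y \<in> path_cell D N (c, m, n)"
    and D: "closure D = {0..T}"
  shows "mdist (path_metric T N) x y \<le> real N * (4 / real n)"
proof -
  have "L2_set (\<lambda>k. x t k - y t k) {1..N} \<le> real N * (4 / real n)" if t: "t \<in> {0..T}" for t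
  proof -
    have "\<bar>x t k - y t k\<bar> \<le> 4 / real n" if k: "k \<in> {1..N}" for k
    proof (rule continuous_le_on_closure[where S = D and f = "\<lambda>t. \<bar>x t k - y t k\<bar>"])
      show "continuous_on (closure D) (\<lambda>t. \<bar>x t k - y t k\<bar>)"
        unfolding D using x(1) y(1) k
        by (intro continuous_intros) (auto simp: mspace_path_metric_iff)
      show "t \<in> closure D" using t D by simp
      fix s assume "s \<in> D"
      then have "\<bar>x s k - real_of_int (c ! nat \<lfloor>real m * s\<rfloor> ! k) / real n\<bar> \<le> 2 / real n"
        "\<bar>y s k - real_of_int (c ! nat \<lfloor>real m * s\<rfloor> ! k) / real n\<bar> \<le> 2 / real n"
        using x(2) y(2) k by (auto simp: path_cell_def)
      then have "\<bar>x s k - y s k\<bar> \<le> 2 / real n + 2 / real n" by linarith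
      then show "\<bar>x s k - y s k\<bar> \<le> 4 / real n" by simp
    qed
    then have "(\<Sum>k=1..N. \<bar>x t k - y t k\<bar>) \<le> real (card {1..N}) * (4 / real n)"
      by (intro sum_bounded_above) auto
    then show ?thesis
      using L2_set_le_sum_abs[of "\<lambda>k. x t k - y t k" "{1..N}"] by simp
  qed
  then show ?thesis
    unfolding path_metric_def by (intro mdist_cfunspace_le) auto
qed

text \<open>
  Every open set of paths is the union of the cells it contains, because each path lies in
  arbitrarily small cells.  As there are only countably many cells, the Borel sets are generated by
  the coordinates.
\<close>
lemma measurable_path_borel:
  assumes f: "\<And>\<omega>. \<omega> \<in> space M \<Longrightarrow> f \<omega> \<in> mspace (path_metric T N)"
    and meas: "\<And>t k. t \<in> {0..T} \<Longrightarrow> k \<in> {1..N} \<Longrightarrow> (\<lambda>\<omega>. f \<omega> t k) \<in> borel_measurable M"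
  shows "f \<in> measurable M (path_borel T N)"
proof -
  obtain D :: "real set" where D: "countable D" "D \<subseteq> {0..T}" "{0..T} \<subseteq> closure D"
    using separable by blast
  have clD: "closure D = {0..T}"
    using D(2,3) closure_minimal[OF D(2)] by auto
  interpret P: Metric_space "mspace (path_metric T N)" "mdist (path_metric T N)"
    by (rule Metric_space_mspace_mdist)
  show ?thesis
    unfolding path_borel_def
  proof (rule measurable_measure_of)
    show "{B. openin (mtopology_of (path_metric T N)) B} \<subseteq> Pow (mspace (path_metric T N))"
      using openin_subset by fastforce
    show "f \<in> space M \<rightarrow> mspace (path_metric T N)" using f by auto
    fix U assume "U \<in> {B. openin (mtopology_of (path_metric T N)) B}"
    then have U: "openin P.mtopology U" by (simp add: mtopology_of_def)
    define I where "I = {i. path_cell D N i \<inter> mspace (path_metric T N) \<subseteq> U}"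
    have "f -` U \<inter> space M = (\<Union>i\<in>I. {\<omega> \<in> space M. f \<omega> \<in> path_cell D N i})"
    proof (intro equalityI subsetI)
      fix \<omega> assume \<omega>: "\<omega> \<in> f -` U \<inter> space M"
      then obtain r where r: "r > 0" "P.mball (f \<omega>) r \<subseteq> U"
        using U unfolding P.openin_mtopology by auto
      obtain n :: nat where n: "max 1 (4 * real N / r) < real n" using reals_Archimedean2 by blast
      then have n0: "0 < n" by simp
      have small: "real N * (4 / real n) < r"
        using n n0 r(1) by (simp add: field_simps)
      obtain c m where c: "f \<omega> \<in> path_cell D N (c, m, n)"
        using path_in_fine_cell[OF f D(2) n0, of \<omega>] \<omega> by blast
      have "path_cell D N (c, m, n) \<inter> mspace (path_metric T N) \<subseteq> P.mball (f \<omega>) r"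
      proof
        fix y assume "y \<in> path_cell D N (c, m, n) \<inter> mspace (path_metric T N)"
        then have "mdist (path_metric T N) (f \<omega>) y \<le> real N * (4 / real n)"
          using f \<omega> c clD by (intro path_cell_diameter) auto
        then show "y \<in> P.mball (f \<omega>) r"
          using small f \<omega> \<open>y \<in> _\<close> by auto
      qed
      then have "(c, m, n) \<in> I" using r by (auto simp: I_def)
      then show "\<omega> \<in> (\<Union>i\<in>I. {\<omega> \<in> space M. f \<omega> \<in> path_cell D N i})" using c \<omega> by blast
    qed (use f in \<open>auto simp: I_def\<close>)
    also have "\<dots> \<in> sets M"
    proof (rule sets.countable_UN'')
      fix i assume "i \<in> I"
      obtain c m n where i: "i = (c, m, n)" by (cases i) auto
      have "{\<omega> \<in> space M. \<bar>f \<omega> t k - z\<bar> \<le> a} \<in> sets M"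
        if "t \<in> D" "k \<in> {1..N}" for t k and a z :: real
      proof -
        have [measurable]: "(\<lambda>\<omega>. f \<omega> t k) \<in> borel_measurable M"
          using meas that D(2) by auto
        show ?thesis by measurable
      qed
      then show "{\<omega> \<in> space M. f \<omega> \<in> path_cell D N i} \<in> sets M"
        unfolding i path_cell_def prod.case mem_Collect_eq
        by (intro sets.sets_Collect_countable_All' D(1) countable_finite[OF finite_atLeastAtMost])
    qed auto
    finally show "f -` U \<inter> space M \<in> sets M" .
  qed
qed

section \<open>Exponential likelihoods with a natural parameter in the interior\<close>

lemma (in complete_measure) measurable_cong_AE_complete:
  assumes f: "f \<in> measurable M N" and eq: "AE x in M. f x = g x" and g: "g \<in> space M \<rightarrow> space N"
  shows "g \<in> measurable M N"
proof (rule measurableI)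
  fix A assume A: "A \<in> sets N"
  show "g -` A \<inter> space M \<in> sets M"
  proof (rule in_sets_AE)
    show "f -` A \<inter> space M \<in> sets M" using f A by (rule measurable_sets)
    show "AE x in M. x \<in> f -` A \<inter> space M \<longleftrightarrow> x \<in> g -` A \<inter> space M"
      using eq by eventually_elim auto
  qed simp
qed (use g in auto)

text \<open>
  The left side is monotone in \<open>a\<close>, so one of the two endpoints \<open>a = c - d\<close> and \<open>a = c + d\<close> bounds
  it; the sum serves both signs of \<open>s\<close>.
\<close>
lemma exp_mult_le_interval:
  fixes a c d s :: real
  assumes "\<bar>a - c\<bar> \<le> d"
  shows "exp (a * s) \<le> exp ((c - d) * s) + exp ((c + d) * s)"
proof (cases "0 \<le> s")
  case True
  then have "exp (a * s) \<le> exp ((c + d) * s)" using assms by (auto intro: mult_right_mono)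
  then show ?thesis using exp_ge_zero[of "(c - d) * s"] by linarith
next
  case False
  then have "exp (a * s) \<le> exp ((c - d) * s)" using assms by (auto intro: mult_right_mono_neg)
  then show ?thesis using exp_ge_zero[of "(c + d) * s"] by linarith
qed

text \<open>
  The quadratic term of \<open>exp \<bar>d s\<bar>\<close> dominates \<open>s\<^sup>2\<close>, and \<open>exp \<bar>d s\<bar>\<close> is at most
  \<open>exp (- d s) + exp (d s)\<close>.
\<close>
lemma square_mult_exp_le:
  fixes c d s :: real
  assumes "0 < d"
  shows "s\<^sup>2 * exp (c * s) \<le> 2 / d\<^sup>2 * (exp ((c - d) * s) + exp ((c + d) * s))"
proof -
  have "\<bar>d * s\<bar>\<^sup>2 / 2 \<le> exp \<bar>d * s\<bar>"
    using exp_lower_Taylor_quadratic[of "\<bar>d * s\<bar>"] by linarith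
  also have "\<dots> \<le> exp (- d * s) + exp (d * s)"
    by (cases "0 \<le> d * s") (auto simp: abs_if)
  finally have "s\<^sup>2 \<le> 2 / d\<^sup>2 * (exp (- d * s) + exp (d * s))"
    using assms by (simp add: field_simps power_mult_distrib)
  then have "s\<^sup>2 * exp (c * s) \<le> 2 / d\<^sup>2 * (exp (- d * s) + exp (d * s)) * exp (c * s)"
    by (rule mult_right_mono) simp
  then show ?thesis by (simp add: algebra_simps flip: exp_add)
qed

text \<open>
  The abstract situation: \<open>L \<theta>\<close> is the likelihood ratio at \<open>\<theta>\<close> with reference value \<open>\<eta>\<close>, viewed as
  a random variable under the reference law.  All integrability below comes from that of \<open>L \<theta>\<close>.
\<close>
locale exponential_likelihood = prob_space M + complete_measure M
  for M :: "'a measure" +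
  fixes L :: "real \<Rightarrow> 'a \<Rightarrow> real" and S :: "'a \<Rightarrow> real" and B \<eta> :: real
  assumes L_integrable: "\<And>\<theta>. 0 < \<theta> \<Longrightarrow> integrable M (L \<theta>)"
    and L_eq: "AE \<omega> in M. \<forall>\<theta>>0. L \<theta> \<omega> = exp ((\<eta> - \<theta>) * S \<omega> + (\<eta>\<^sup>2 - \<theta>\<^sup>2) * B)"
    and reference_pos: "0 < \<eta>"
begin

text \<open>
  The statistic is recovered from the likelihood at one value other than \<open>\<eta>\<close>, but
  only almost surely; completeness of the space turns this into measurability.
\<close>
lemma statistic_measurable [measurable]: "S \<in> borel_measurable M"
proof (rule measurable_cong_AE_complete)
  have [measurable]: "L (\<eta> + 1) \<in> borel_measurable M"
    using L_integrable[of "\<eta> + 1"] reference_pos by auto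
  show "(\<lambda>\<omega>. (\<eta>\<^sup>2 - (\<eta> + 1)\<^sup>2) * B - ln (L (\<eta> + 1) \<omega>)) \<in> borel_measurable M"
    by measurable
  show "AE \<omega> in M. (\<eta>\<^sup>2 - (\<eta> + 1)\<^sup>2) * B - ln (L (\<eta> + 1) \<omega>) = S \<omega>"
    using L_eq by eventually_elim (use reference_pos in simp)
qed simp

text \<open>
  Up to a constant factor, \<open>exp (c S)\<close> is the likelihood at \<open>\<theta> = \<eta> - c\<close>.
\<close>
lemma integrable_exp_statistic:
  assumes "c < \<eta>"
  shows "integrable M (\<lambda>\<omega>. exp (c * S \<omega>))"
proof (rule integrable_cong_AE_imp)
  define \<theta> where "\<theta> = \<eta> - c"
  have "0 < \<theta>" using assms by (simp add: \<theta>_def)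
  then show "integrable M (\<lambda>\<omega>. exp (- (\<eta>\<^sup>2 - \<theta>\<^sup>2) * B) * L \<theta> \<omega>)"
    by (intro integrable_mult_right L_integrable)
  show "AE \<omega> in M. exp (- (\<eta>\<^sup>2 - \<theta>\<^sup>2) * B) * L \<theta> \<omega> = exp (c * S \<omega>)"
    using L_eq by eventually_elim (use \<open>0 < \<theta>\<close> in \<open>simp add: \<theta>_def algebra_simps flip: exp_add\<close>)
qed simp

lemma integrable_square_mult_exp_statistic:
  assumes "c < \<eta>"
  shows "integrable M (\<lambda>\<omega>. (S \<omega>)\<^sup>2 * exp (c * S \<omega>))"
proof -
  \<comment> \<open>Half of the distance to the boundary, so that \<open>c + d\<close> stays below \<open>\<eta>\<close>.\<close>
  define d where "d = (\<eta> - c) / 2"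
  have d: "0 < d" "c - d < \<eta>" "c + d < \<eta>" using assms by (auto simp: d_def field_simps)
  have "integrable M (\<lambda>\<omega>. 2 / d\<^sup>2 * (exp ((c - d) * S \<omega>) + exp ((c + d) * S \<omega>)))"
    by (intro integrable_mult_right Bochner_Integration.integrable_add integrable_exp_statistic d)
  then show ?thesis
    by (rule Bochner_Integration.integrable_bound)
       (auto intro!: AE_I2 order_trans[OF square_mult_exp_le[OF d(1)]])
qed

lemma likelihood_continuous:
  "AE \<omega> in M. continuous_on {0<..} (\<lambda>\<theta>. L \<theta> \<omega>)"
  using L_eq
proof eventually_elim
  fix \<omega> assume "\<forall>\<theta>>0. L \<theta> \<omega> = exp ((\<eta> - \<theta>) * S \<omega> + (\<eta>\<^sup>2 - \<theta>\<^sup>2) * B)"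
  then have "continuous_on {0<..} (\<lambda>\<theta>. L \<theta> \<omega>) \<longleftrightarrow>
    continuous_on {0<..} (\<lambda>\<theta>. exp ((\<eta> - \<theta>) * S \<omega> + (\<eta>\<^sup>2 - \<theta>\<^sup>2) * B))"
    by (intro continuous_on_cong) auto
  then show "continuous_on {0<..} (\<lambda>\<theta>. L \<theta> \<omega>)" by (auto intro!: continuous_intros)
qed

lemma finite_fisher_information_likelihood: "finite_fisher_information M L \<eta>"
proof -
  have D: "AE \<omega> in M. ((\<lambda>\<theta>. ln (L \<theta> \<omega>)) has_real_derivative - S \<omega> - 2 * \<eta> * B) (at \<eta>)"
    using L_eq
  proof eventually_elim
    fix \<omega> assume L: "\<forall>\<theta>>0. L \<theta> \<omega> = exp ((\<eta> - \<theta>) * S \<omega> + (\<eta>\<^sup>2 - \<theta>\<^sup>2) * B)"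
    have "((\<lambda>\<theta>. (\<eta> - \<theta>) * S \<omega> + (\<eta>\<^sup>2 - \<theta>\<^sup>2) * B) has_real_derivative - S \<omega> - 2 * \<eta> * B) (at \<eta>)"
      by (auto intro!: derivative_eq_intros)
    then show "((\<lambda>\<theta>. ln (L \<theta> \<omega>)) has_real_derivative - S \<omega> - 2 * \<eta> * B) (at \<eta>)"
      by (rule has_field_derivative_transform_within_open[where S = "{0<..}"])
         (use L reference_pos in auto)
  qed
  have score: "AE \<omega> in M. (- S \<omega> - 2 * \<eta> * B)\<^sup>2 = (score L \<eta> \<omega>)\<^sup>2"
    using D by eventually_elim (simp add: score_def DERIV_imp_deriv)
  have "integrable M (\<lambda>\<omega>. 2 * (S \<omega>)\<^sup>2 + 2 * (2 * \<eta> * B)\<^sup>2)"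
    using integrable_square_mult_exp_statistic[of 0] reference_pos by simp
  then have int: "integrable M (\<lambda>\<omega>. (- S \<omega> - 2 * \<eta> * B)\<^sup>2)"
  proof (rule Bochner_Integration.integrable_bound, goal_cases)
    case 2
    have "(- s - b)\<^sup>2 \<le> 2 * s\<^sup>2 + 2 * b\<^sup>2" for s b :: real
      using zero_le_power2[of "s - b"] by (simp add: power2_eq_square algebra_simps)
    then show ?case by (auto intro!: AE_I2)
  qed simp
  have "integrable M (\<lambda>\<omega>. (score L \<eta> \<omega>)\<^sup>2)"
    by (rule integrable_cong_AE_imp[OF int measurable_cong_AE_complete[OF _ score] score]) auto
  then show ?thesis
    unfolding finite_fisher_information_def
    using D by (auto elim!: eventually_mono simp: real_differentiable_def)
qed

text \<open>
  The derivative of \<open>\<theta> \<mapsto> sqrt (L \<theta> \<omega>)\<close>, as a function of the value \<open>s\<close> of the statistic.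
\<close>
definition root_derivative :: "real \<Rightarrow> real \<Rightarrow> real" where
  "root_derivative \<theta> s =
     - (s + 2 * \<theta> * B) / 2 * exp (((\<eta> - \<theta>) * s + (\<eta>\<^sup>2 - \<theta>\<^sup>2) * B) / 2)"

lemma root_likelihood_derivative:
  "AE \<omega> in M. \<forall>\<theta>>0. ((\<lambda>\<theta>. sqrt (L \<theta> \<omega>)) has_real_derivative root_derivative \<theta> (S \<omega>)) (at \<theta>)"
  using L_eq
proof eventually_elim
  fix \<omega> assume L: "\<forall>\<theta>>0. L \<theta> \<omega> = exp ((\<eta> - \<theta>) * S \<omega> + (\<eta>\<^sup>2 - \<theta>\<^sup>2) * B)"
  show "\<forall>\<theta>>0. ((\<lambda>\<theta>. sqrt (L \<theta> \<omega>)) has_real_derivative root_derivative \<theta> (S \<omega>)) (at \<theta>)"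
  proof (intro allI impI)
    fix \<theta> :: real assume "0 < \<theta>"
    have root: "sqrt (exp x) = exp (x / 2)" for x :: real
      by (rule real_sqrt_unique) (simp_all flip: exp_of_nat_mult)
    have "((\<lambda>\<theta>. ((\<eta> - \<theta>) * S \<omega> + (\<eta>\<^sup>2 - \<theta>\<^sup>2) * B) / 2)
        has_real_derivative - (S \<omega> + 2 * \<theta> * B) / 2) (at \<theta>)"
      by (auto intro!: derivative_eq_intros)
    from DERIV_fun_exp[OF this]
    have "((\<lambda>\<theta>. exp (((\<eta> - \<theta>) * S \<omega> + (\<eta>\<^sup>2 - \<theta>\<^sup>2) * B) / 2))
        has_real_derivative root_derivative \<theta> (S \<omega>)) (at \<theta>)"
      by (simp only: root_derivative_def mult.commute)
    then show "((\<lambda>\<theta>. sqrt (L \<theta> \<omega>)) has_real_derivative root_derivative \<theta> (S \<omega>)) (at \<theta>)"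
      by (rule has_field_derivative_transform_within_open[where S = "{0<..}"])
         (use L \<open>0 < \<theta>\<close> in \<open>auto simp: root\<close>)
  qed
qed

text \<open>
  A dominating function for the squared root derivatives at all parameters within \<open>\<theta> / 2\<close> of
  \<open>\<theta>\<close>.  With this radius the larger tilt is \<open>\<eta> - \<theta> / 2\<close>, still below \<open>\<eta>\<close>.
\<close>
definition root_derivative_bound :: "real \<Rightarrow> real \<Rightarrow> real" where
  "root_derivative_bound \<theta> s =
     (s\<^sup>2 + 4 * (2 * \<theta>)\<^sup>2 * B\<^sup>2) *
     (exp ((\<eta> - \<theta> - \<theta> / 2) * s) + exp ((\<eta> - \<theta> + \<theta> / 2) * s)) *
     exp ((\<eta>\<^sup>2 + (2 * \<theta>)\<^sup>2) * \<bar>B\<bar>)"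

lemma root_derivative_le_bound:
  assumes "0 < \<theta>" and t: "\<bar>t - \<theta>\<bar> \<le> \<theta> / 2"
  shows "(root_derivative t s)\<^sup>2 \<le> root_derivative_bound \<theta> s"
proof -
  have t0: "0 < t" "t \<le> 2 * \<theta>" using assms by linarith+
  then have tt: "t\<^sup>2 \<le> (2 * \<theta>)\<^sup>2" by (intro power_mono) auto
  have "(s + 2 * t * B)\<^sup>2 \<le> 2 * s\<^sup>2 + 2 * (2 * t * B)\<^sup>2"
    using zero_le_power2[of "s - 2 * t * B"] by (simp add: power2_eq_square algebra_simps)
  also have "(2 * t * B)\<^sup>2 = 4 * t\<^sup>2 * B\<^sup>2" by (simp add: power_mult_distrib)
  also have "4 * t\<^sup>2 * B\<^sup>2 \<le> 4 * (2 * \<theta>)\<^sup>2 * B\<^sup>2"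
    using tt by (intro mult_mono) auto
  finally have le: "(s + 2 * t * B)\<^sup>2 \<le> 2 * s\<^sup>2 + 2 * (4 * (2 * \<theta>)\<^sup>2 * B\<^sup>2)" by simp
  have 1: "(s + 2 * t * B)\<^sup>2 / 4 \<le> s\<^sup>2 + 4 * (2 * \<theta>)\<^sup>2 * B\<^sup>2"
  proof -
    have "0 \<le> s\<^sup>2" "0 \<le> 4 * (2 * \<theta>)\<^sup>2 * B\<^sup>2" by simp_all
    then show ?thesis using le by linarith
  qed
  have 2: "exp ((\<eta> - t) * s) \<le> exp ((\<eta> - \<theta> - \<theta> / 2) * s) + exp ((\<eta> - \<theta> + \<theta> / 2) * s)"
    by (rule exp_mult_le_interval) (use t in linarith)
  have "(\<eta>\<^sup>2 - t\<^sup>2) * B \<le> \<bar>\<eta>\<^sup>2 - t\<^sup>2\<bar> * \<bar>B\<bar>"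
    by (simp flip: abs_mult)
  also have "\<dots> \<le> (\<eta>\<^sup>2 + (2 * \<theta>)\<^sup>2) * \<bar>B\<bar>"
  proof (rule mult_right_mono)
    show "\<bar>\<eta>\<^sup>2 - t\<^sup>2\<bar> \<le> \<eta>\<^sup>2 + (2 * \<theta>)\<^sup>2"
      using tt zero_le_power2[of \<eta>] zero_le_power2[of t] by linarith
  qed simp
  finally have 3: "exp ((\<eta>\<^sup>2 - t\<^sup>2) * B) \<le> exp ((\<eta>\<^sup>2 + (2 * \<theta>)\<^sup>2) * \<bar>B\<bar>)" by simp
  have sq: "(exp (x / 2))\<^sup>2 = exp x" for x :: real
    by (simp flip: exp_of_nat_mult)
  have "(root_derivative t s)\<^sup>2 =
      (s + 2 * t * B)\<^sup>2 / 4 * exp ((\<eta> - t) * s) * exp ((\<eta>\<^sup>2 - t\<^sup>2) * B)"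
    unfolding root_derivative_def power_mult_distrib sq power_divide power2_minus exp_add
    by simp
  also have "\<dots> \<le> root_derivative_bound \<theta> s"
    unfolding root_derivative_bound_def using 1 2 3 by (intro mult_mono) auto
  finally show ?thesis .
qed

lemma integrable_root_derivative_bound:
  assumes "0 < \<theta>"
  shows "integrable M (\<lambda>\<omega>. root_derivative_bound \<theta> (S \<omega>))"
proof -
  define a b C K where "a = \<eta> - \<theta> - \<theta> / 2" and "b = \<eta> - \<theta> + \<theta> / 2"
    and "C = 4 * (2 * \<theta>)\<^sup>2 * B\<^sup>2" and "K = exp ((\<eta>\<^sup>2 + (2 * \<theta>)\<^sup>2) * \<bar>B\<bar>)"
  have ab: "a < \<eta>" "b < \<eta>" using assms by (auto simp: a_def b_def)
  have "root_derivative_bound \<theta> s =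
      K * ((s\<^sup>2 * exp (a * s) + s\<^sup>2 * exp (b * s)) + C * (exp (a * s) + exp (b * s)))" for s
    unfolding root_derivative_bound_def a_def[symmetric] b_def[symmetric] C_def[symmetric] K_def[symmetric]
    by (simp only: distrib_left distrib_right mult_ac add_ac)
  then show ?thesis
    using ab by (simp only:)
      (intro integrable_mult_right Bochner_Integration.integrable_add
        integrable_square_mult_exp_statistic integrable_exp_statistic)
qed

lemma root_derivative_L2_continuous:
  "L2_continuous_on M {0<..} (\<lambda>\<theta> \<omega>. deriv (\<lambda>\<theta>. sqrt (L \<theta> \<omega>)) \<theta>)"
proof -
  define \<psi> where "\<psi> = (\<lambda>\<theta> \<omega>. deriv (\<lambda>\<theta>. sqrt (L \<theta> \<omega>)) \<theta>)"
  have \<psi>: "AE \<omega> in M. \<forall>\<theta>>0. \<psi> \<theta> \<omega> = root_derivative \<theta> (S \<omega>)"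
    using root_likelihood_derivative
    by eventually_elim (auto simp: \<psi>_def DERIV_imp_deriv)
  have [measurable]: "(\<lambda>\<omega>. root_derivative \<theta> (S \<omega>)) \<in> borel_measurable M" for \<theta>
    unfolding root_derivative_def by measurable
  have meas [measurable]: "\<psi> \<theta> \<in> borel_measurable M" if "0 < \<theta>" for \<theta>
  proof (rule measurable_cong_AE_complete)
    show "AE \<omega> in M. root_derivative \<theta> (S \<omega>) = \<psi> \<theta> \<omega>"
      using \<psi> by eventually_elim (use that in simp)
  qed simp_all
  have "integrable M (\<lambda>\<omega>. (\<psi> \<theta> \<omega>)\<^sup>2)" if "0 < \<theta>" for \<theta>
  proof (rule Bochner_Integration.integrable_bound[OF integrable_root_derivative_bound[OF that]])
    show "AE \<omega> in M. norm ((\<psi> \<theta> \<omega>)\<^sup>2) \<le> norm (root_derivative_bound \<theta> (S \<omega>))"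
      using \<psi>
    proof eventually_elim
      case (elim \<omega>)
      then show ?case
        using that root_derivative_le_bound[of \<theta> \<theta> "S \<omega>"] by (simp add: abs_le_iff)
    qed
  qed (use meas[OF that] in measurable)
  moreover have "((\<lambda>t. \<integral>\<omega>. (\<psi> t \<omega> - \<psi> \<theta> \<omega>)\<^sup>2 \<partial>M) \<longlongrightarrow> 0) (at \<theta> within {0<..})"
    if \<theta>: "0 < \<theta>" for \<theta>
    unfolding tendsto_at_iff_sequentially comp_def
  proof (intro allI impI)
    fix X assume X: "\<forall>i. X i \<in> {0<..} - {\<theta>}" "X \<longlonglongrightarrow> \<theta>"
    have "eventually (\<lambda>i. dist (X i) \<theta> < \<theta> / 2) sequentially"
      using X(2) \<theta> by (intro tendstoD) auto
    then obtain n where n: "\<And>i. n \<le> i \<Longrightarrow> \<bar>X i - \<theta>\<bar> \<le> \<theta> / 2"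
      unfolding eventually_sequentially dist_real_def by (meson less_imp_le)
    have Xpos: "0 < X i" for i using X(1) by auto
    \<comment> \<open>The sequence is shifted by \<open>n\<close> because the dominating function serves only parameters within
      \<open>\<theta> / 2\<close> of \<open>\<theta>\<close>.\<close>
    have "(\<lambda>i. \<integral>\<omega>. (\<psi> (X (i + n)) \<omega> - \<psi> \<theta> \<omega>)\<^sup>2 \<partial>M) \<longlonglongrightarrow> (\<integral>\<omega>. 0 \<partial>M)"
    proof (rule integral_dominated_convergence)
      show "integrable M (\<lambda>\<omega>. 4 * root_derivative_bound \<theta> (S \<omega>))"
        using integrable_root_derivative_bound[OF \<theta>] by simp
      show "(\<lambda>\<omega>. (\<psi> (X (i + n)) \<omega> - \<psi> \<theta> \<omega>)\<^sup>2) \<in> borel_measurable M" for i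
        using meas[OF Xpos[of "i + n"]] meas[OF \<theta>] by measurable
      show "AE \<omega> in M. (\<lambda>i. (\<psi> (X (i + n)) \<omega> - \<psi> \<theta> \<omega>)\<^sup>2) \<longlonglongrightarrow> 0"
        using \<psi>
      proof eventually_elim
        case (elim \<omega>)
        have "(\<lambda>i. (root_derivative (X (i + n)) (S \<omega>) - root_derivative \<theta> (S \<omega>))\<^sup>2) \<longlonglongrightarrow>
            (root_derivative \<theta> (S \<omega>) - root_derivative \<theta> (S \<omega>))\<^sup>2"
          unfolding root_derivative_def
          by (intro tendsto_intros LIMSEQ_ignore_initial_segment X) auto
        then show ?case using elim Xpos \<theta> by simp
      qed
      show "AE \<omega> in M. norm ((\<psi> (X (i + n)) \<omega> - \<psi> \<theta> \<omega>)\<^sup>2) \<le> 4 * root_derivative_bound \<theta> (S \<omega>)" for i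
        using \<psi>
      proof eventually_elim
        case (elim \<omega>)
        have "(a - b)\<^sup>2 \<le> 2 * a\<^sup>2 + 2 * b\<^sup>2" for a b :: real
          using zero_le_power2[of "a + b"] by (simp add: power2_eq_square algebra_simps)
        from this[of "root_derivative (X (i + n)) (S \<omega>)" "root_derivative \<theta> (S \<omega>)"]
        show ?case
          using root_derivative_le_bound[OF \<theta> n[of "i + n"], of "S \<omega>"]
            root_derivative_le_bound[of \<theta> \<theta> "S \<omega>"] elim Xpos[of "i + n"] \<theta>
          by simp
      qed
    qed simp
    then show "(\<lambda>i. \<integral>\<omega>. (\<psi> (X i) \<omega> - \<psi> \<theta> \<omega>)\<^sup>2 \<partial>M) \<longlonglongrightarrow> 0"
      by (simp add: LIMSEQ_offset[where k = n])
  qed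
  ultimately show ?thesis
    unfolding L2_continuous_on_def \<psi>_def[symmetric] using meas by auto
qed

end

section \<open>The law of the observed modes\<close>

text \<open>
  The integral along \<open>X\<close> is the total mass of \<open>Q\<close>.
\<close>
lemma integrable_RN_density_along:
  assumes X: "X \<in> measurable M R" and Q: "prob_space Q"
    and p: "is_RN_density (distr M R X) Q p"
  shows "integrable M (\<lambda>\<omega>. p (X \<omega>))"
proof (rule integrableI_nonneg)
  have pm: "p \<in> borel_measurable R" and nn: "\<And>x. x \<in> space R \<Longrightarrow> 0 \<le> p x"
    and dens: "density (distr M R X) (\<lambda>x. ennreal (p x)) = Q"
    using p by (auto simp: is_RN_density_def)
  show "(\<lambda>\<omega>. p (X \<omega>)) \<in> borel_measurable M" using X pm by measurable
  show "AE \<omega> in M. 0 \<le> p (X \<omega>)"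
    using nn measurable_space[OF X] by (intro AE_I2) auto
  have "(\<integral>\<^sup>+\<omega>. ennreal (p (X \<omega>)) \<partial>M) = (\<integral>\<^sup>+x. ennreal (p x) \<partial>distr M R X)"
    using X pm by (subst nn_integral_distr) auto
  also have "\<dots> = emeasure (density (distr M R X) (\<lambda>x. ennreal (p x))) (space R)"
    using pm by (subst emeasure_density) (auto intro!: nn_integral_cong)
  also have "\<dots> = emeasure Q (space Q)"
    unfolding dens[symmetric] by simp
  also have "\<dots> = 1" using prob_space.emeasure_space_1[OF Q] .
  finally show "(\<integral>\<^sup>+\<omega>. ennreal (p (X \<omega>)) \<partial>M) < \<infinity>" by simp
qed

lemma measurable_path_of_mode:
  assumes basis: "stochastic_basis M F" and bm: "independent_brownian_motions M F w"
    and u0: "\<And>k. 1 \<le> k \<Longrightarrow> u0 k \<in> borel_measurable (F 0)"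
  shows "path_of T N (mode \<mu> q \<sigma> u0 w \<theta>) \<in> measurable M (path_borel T N)"
proof (rule measurable_path_borel)
  have sub: "subalgebra M (F t)" if "0 \<le> t" for t
    using basis that by (simp add: stochastic_basis_def)
  have wm: "w k t \<in> borel_measurable M" if "1 \<le> k" "0 \<le> t" for k t
  proof (rule measurable_from_subalg[OF sub[OF that(2)]])
    show "w k t \<in> borel_measurable (F t)"
      using bm that unfolding independent_brownian_motions_def brownian_motion_def by blast
  qed
  have u0m: "u0 k \<in> borel_measurable M" if "1 \<le> k" for k
    using u0[OF that] measurable_from_subalg[OF sub] by blast
  show "(\<lambda>\<omega>. path_of T N (mode \<mu> q \<sigma> u0 w \<theta>) \<omega> t k) \<in> borel_measurable M"
    if "t \<in> {0..T}" "k \<in> {1..N}" for t k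
  proof -
    have [measurable]: "w k t \<in> borel_measurable M" "u0 k \<in> borel_measurable M"
      using wm u0m that by auto
    have "(\<lambda>\<omega>. mode \<mu> q \<sigma> u0 w \<theta> k t \<omega>) \<in> borel_measurable M"
      unfolding mode_def by measurable
    then show ?thesis using that by (simp add: path_of_def)
  qed
  fix \<omega> assume \<omega>: "\<omega> \<in> space M"
  have "continuous_on {0..T} (\<lambda>t. path_of T N (mode \<mu> q \<sigma> u0 w \<theta>) \<omega> t k)" if k: "k \<in> {1..N}" for k
  proof -
    have "continuous_on {0..} (\<lambda>t. w k t \<omega>)"
      using bm k \<omega> by (auto simp: independent_brownian_motions_def brownian_motion_def)
    then have "continuous_on {0..T} (\<lambda>t. w k t \<omega>)"
      by (rule continuous_on_subset) auto
    then have "continuous_on {0..T} (\<lambda>t. mode \<mu> q \<sigma> u0 w \<theta> k t \<omega>)"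
      unfolding mode_def by (intro continuous_intros)
    then show ?thesis
      by (rule continuous_on_eq) (use k in \<open>simp add: path_of_def\<close>)
  qed
  then show "path_of T N (mode \<mu> q \<sigma> u0 w \<theta>) \<omega> \<in> mspace (path_metric T N)"
    by (auto simp: mspace_path_metric_iff path_of_def)
qed

theorem theorem2p3:
  fixes M :: "'a measure" and F :: "real \<Rightarrow> 'a measure"
    and w :: "nat \<Rightarrow> real \<Rightarrow> 'a \<Rightarrow> real" and u0 :: "nat \<Rightarrow> 'a \<Rightarrow> real"
    and \<mu> q :: "nat \<Rightarrow> real" and \<sigma> T \<theta>\<^sub>0 :: real and N :: nat
    and u :: "real \<Rightarrow> nat \<Rightarrow> real \<Rightarrow> 'a \<Rightarrow> real"
    and p :: "real \<Rightarrow> real \<Rightarrow> (real \<Rightarrow> nat \<Rightarrow> real) \<Rightarrow> real"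
  assumes "stochastic_basis M F"
    and "independent_brownian_motions M F w"
    and "\<And>k. 1 \<le> k \<Longrightarrow> 0 < \<mu> k" and "filterlim \<mu> at_top sequentially"
    and "\<And>k. 1 \<le> k \<Longrightarrow> 0 < q k"
    and "0 < \<sigma>" and "0 < T"
    and "\<And>k. 1 \<le> k \<Longrightarrow> u0 k \<in> borel_measurable (F 0)"
    and "\<And>k. 1 \<le> k \<Longrightarrow> AE \<omega> in M. u0 k \<omega> \<noteq> 0"
    and u_def: "u = mode \<mu> q \<sigma> u0 w"
    and "0 < \<theta>\<^sub>0"
    and "1 \<le> N"
    \<comment> \<open>\<open>p \<eta> \<theta>\<close> is the version of \<open>dP_N^\<theta> / dP_N^\<eta>\<close> given by the density formula\<close>
    and "\<And>\<eta> \<theta>. 0 < \<eta> \<Longrightarrow> 0 < \<theta> \<Longrightarrow>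
           is_RN_density (path_law M T N (u \<eta>)) (path_law M T N (u \<theta>)) (p \<eta> \<theta>)"
    and "\<And>\<eta>. 0 < \<eta> \<Longrightarrow> AE \<omega> in M. \<forall>\<theta>>0.
           p \<eta> \<theta> (path_of T N (u \<eta>) \<omega>) = girsanov_density M \<mu> q \<sigma> T N (u \<eta>) \<eta> \<theta> \<omega>"
  shows "(AE \<omega> in M. continuous_on {0<..} (\<lambda>\<theta>. p \<theta>\<^sub>0 \<theta> (path_of T N (u \<theta>\<^sub>0) \<omega>)))
    \<and> (\<forall>\<eta>>0. finite_fisher_information M (\<lambda>\<theta> \<omega>. p \<eta> \<theta> (path_of T N (u \<eta>) \<omega>)) \<eta>)
    \<and> (AE \<omega> in M. \<forall>\<theta>>0. (\<lambda>\<theta>. sqrt (p \<theta>\<^sub>0 \<theta> (path_of T N (u \<theta>\<^sub>0) \<omega>))) differentiable (at \<theta>))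
    \<and> L2_continuous_on M {0<..}
        (\<lambda>\<theta> \<omega>. deriv (\<lambda>\<theta>. sqrt (p \<theta>\<^sub>0 \<theta> (path_of T N (u \<theta>\<^sub>0) \<omega>))) \<theta>)"
proof -
  interpret prob_space M using assms(1) by (simp add: stochastic_basis_def)
  interpret complete_measure M using assms(1) by (simp add: stochastic_basis_def)
  \<comment> \<open>The likelihood formula in exponential form: \<open>S \<eta>\<close> collects the random part of the
    exponent, \<open>B\<close> the deterministic one.\<close>
  define S where "S \<eta> \<omega> = 1 / \<sigma>\<^sup>2 *
    (\<Sum>k=1..N. \<mu> k / (q k)\<^sup>2 * ito_integral M T (\<lambda>t \<omega>. 1 / u \<eta> k t \<omega>) (u \<eta> k) \<omega>)" for \<eta> \<omega>
  define B where "B = T / (2 * \<sigma>\<^sup>2) * (\<Sum>k=1..N. (\<mu> k)\<^sup>2 / (q k)\<^sup>2)"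
  have path: "path_of T N (u \<eta>) \<in> measurable M (path_borel T N)" for \<eta>
    unfolding u_def using assms(1,2,8) by (rule measurable_path_of_mode)
  have E: "exponential_likelihood M (\<lambda>\<theta> \<omega>. p \<eta> \<theta> (path_of T N (u \<eta>) \<omega>)) (S \<eta>) B \<eta>"
    if \<eta>: "0 < \<eta>" for \<eta>
  proof unfold_locales
    show "integrable M (\<lambda>\<omega>. p \<eta> \<theta> (path_of T N (u \<eta>) \<omega>))" if "0 < \<theta>" for \<theta>
      using path prob_space_distr[OF path] assms(13)[OF \<eta> that]
      unfolding path_law_def by (rule integrable_RN_density_along)
    show "AE \<omega> in M. \<forall>\<theta>>0. p \<eta> \<theta> (path_of T N (u \<eta>) \<omega>) =
        exp ((\<eta> - \<theta>) * S \<eta> \<omega> + (\<eta>\<^sup>2 - \<theta>\<^sup>2) * B)"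
      using assms(14)[OF \<eta>] by eventually_elim (simp add: girsanov_density_def S_def B_def)
  qed (rule \<eta>)
  note E0 = E[OF assms(11)]
  have "AE \<omega> in M. \<forall>\<theta>>0. (\<lambda>\<theta>. sqrt (p \<theta>\<^sub>0 \<theta> (path_of T N (u \<theta>\<^sub>0) \<omega>))) differentiable (at \<theta>)"
    using exponential_likelihood.root_likelihood_derivative[OF E0]
    by eventually_elim (auto simp: real_differentiable_def)
  then show ?thesis
    using exponential_likelihood.likelihood_continuous[OF E0]
      exponential_likelihood.finite_fisher_information_likelihood[OF E]
      exponential_likelihood.root_derivative_L2_continuous[OF E0]
    by blast
qed

end
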